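(* Let $a,b\in I$ with $a<b$, let $\alpha,\beta\in\mathbb{R}$, and let $f,\bar f:[a,b]_{n,q}\times\mathbb{R}\times\mathbb{R}\to\mathbb{R}$ satisfy the standing assumptions listed in the context. Put $$\mathcal{L}[y]=\int_a^b f(t,y(qt^n),D_{n,q}y(t))\,d_{n,q}t,\qquad \bar{\mathcal{L}}[\bar y]=\int_a^b \bar f(t,\bar y(qt^n),D_{n,q}\bar y(t))\,d_{n,q}t .$$ Let $y=z(t,\bar y)$ be a transformation having a unique inverse $\bar y=\bar z(t,y)$ for all $t\in[a,b]_{n,q}$, such that there is a one-to-one correspondence $y(t)\Leftrightarrow\bar y(t)$ (given by $y(t)=z(t,\bar y(t))$, $\bar y(t)=\bar z(t,y(t))$) between all functions $y\in\mathbb{E}([a,b]_{n,q},\mathbb{R})$ satisfying $$y(a)=\alpha,\quad y(b)=\beta \qquad (1)$$ and all functions $\bar y\in\mathbb{E}([a,b]_{n,q},\mathbb{R})$ satisfying $$\bar y(a)=\bar z(a,\alpha),\quad \bar y(b)=\bar z(b,\beta). \qquad (2)$$ Suppose that there exists a function $G:[a,b]_{n,q}\times\mathbb{R}\to\mathbb{R}$ such that the functional identity $$f(t,y(qt^n),D_{n,q}y(t))-\bar f(t,\bar y(qt^n),D_{n,q}\bar y(t))=D_{n,q}G(t,\bar y(t))$$ holds (for all such corresponding $y,\bar y$ and all $t\in[a,b]_{n,q}$, the right-hand side being the $n,q$-derivative of $t\mapsto G(t,\bar y(t))$). If $\bar y^*$ yields the extremum of $\bar{\mathcal{L}}$ among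 the functions satisfying (2), with $\bar y^*$ satisfying (2), then $y^*=z(t,\bar y^* )$ yields the extremum (of the same type: minimum or maximum) of $\mathcal{L}$ among the functions satisfying (1).
   Context: Fix $0<q<1$ and an odd positive integer $n$. Put $\theta=\infty$ if $n=1$ and $\theta=q^{1/(1-n)}$ if $n\ge 3$; $S=\{0\}$ if $n=1$ and $S=\{-\theta,0,\theta\}$ if $n\ge 3$; $I=(-\theta,\theta)$; $[0]_n=0$ and $[k]_n=\sum_{i=0}^{k-1}n^i$ for $k\ge 1$. Power difference operator: $D_{n,q}y(t)=\dfrac{y(qt^n)-y(t)}{qt^n-t}$ if $t\notin S$, and $D_{n,q}y(t)=y'(t)$ if $t\in S$ (provided the derivative exists). For functions defined only on $[a,b]_{n,q}$ (below) the same formula is used, the derivative at $0$ being the limit of difference quotients through points of $[a,b]_{n,q}$. Power integral: for $x\in I$, $$\int_0^x u(t)\,d_{n,q}t=-\sum_{k=0}^\infty q^{[k]_n}x^{n^k}\bigl(q^{n^k}x^{n^k(n-1)}-1\bigr)u\bigl(q^{[k]_n}x^{n^k}\bigr),$$ and $\int_a^b u\,d_{n,q}t=\int_0^b u\,d_{n,q}t-\int_0^a u\,d_{n,q}t$. All series that occur are assumed convergent. $[a,b]_{n,q}=\{q^{[k]_n}a^{n^k}:k\in\mathbb{N}_0\}\cup\{q^{[k]_n}b^{n^k}:k\in\mathbb{N}_0\}\cup\{0\}$. $\mathbb{E}([a,b]_{n,q},\mathbb{R})$ is the linear space of continuous bounded functions $y:[a,b]_{n,q}\to\mathbb{R}$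 whose $n,q$-derivative is continuous and bounded on $[a,b]_{n,q}$. Standing assumptions on $f$ and $\bar f$: for $F\in\{f,\bar f\}$, $(u,v)\mapsto F(t,u,v)$ is $C^1(\mathbb{R}^2,\mathbb{R})$ for every $t\in[a,b]_{n,q}$, and $F(\cdot,y(\cdot),D_{n,q}y(\cdot))$, $\partial_2F(\cdot,y(\cdot),D_{n,q}y(\cdot))$, $\partial_3F(\cdot,y(\cdot),D_{n,q}y(\cdot))$ are continuous and bounded on $[a,b]_{n,q}$ for all admissible functions $y$ (those in $\mathbb{E}([a,b]_{n,q},\mathbb{R})$ satisfying the endpoint conditions); $\partial_2,\partial_3$ denote partial derivatives in the second and third arguments. *)

theory Defs
  imports "HOL-Analysis.Analysis"
begin

definition nq_theta :: "nat \<Rightarrow> real \<Rightarrow> ereal" where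
  "nq_theta n q = (if n = 1 then \<infinity> else ereal (q powr (1 / (1 - real n))))"

definition nq_I :: "nat \<Rightarrow> real \<Rightarrow> real set" where
  "nq_I n q = {t. - nq_theta n q < ereal t \<and> ereal t < nq_theta n q}"

text \<open>The fixed points of \<open>t \<mapsto> q * t ^ n\<close>. For \<open>n = 1\<close> this is just \<open>{0}\<close>, as no real number
  is infinite.\<close>

definition nq_S :: "nat \<Rightarrow> real \<Rightarrow> real set" where
  "nq_S n q = insert 0 {t. ereal t \<in> {- nq_theta n q, nq_theta n q}}"

definition nq_bracket :: "nat \<Rightarrow> nat \<Rightarrow> nat" where
  "nq_bracket n k = (\<Sum>i<k. n ^ i)"

definition nq_orbit :: "nat \<Rightarrow> real \<Rightarrow> real \<Rightarrow> nat \<Rightarrow> real" where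
  "nq_orbit n q x k = q ^ nq_bracket n k * x ^ (n ^ k)"

definition nq_set :: "nat \<Rightarrow> real \<Rightarrow> real \<Rightarrow> real \<Rightarrow> real set" where
  "nq_set n q a b = range (nq_orbit n q a) \<union> range (nq_orbit n q b) \<union> {0}"

text \<open>The power difference operator for a function with domain \<open>A\<close>. At the points of \<open>nq_S n q\<close>
  the derivative is the limit of difference quotients through points of \<open>A\<close>; its value is
  meaningful only if \<open>nq_differentiable_on\<close> holds.\<close>

definition nq_deriv :: "nat \<Rightarrow> real \<Rightarrow> real set \<Rightarrow> (real \<Rightarrow> real) \<Rightarrow> real \<Rightarrow> real" where
  "nq_deriv n q A y t =
     (if t \<notin> nq_S n q then (y (q * t ^ n) - y t) / (q * t ^ n - t)
      else (THE d. (y has_real_derivative d) (at t within A)))"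

definition nq_differentiable_on :: "nat \<Rightarrow> real \<Rightarrow> real set \<Rightarrow> (real \<Rightarrow> real) \<Rightarrow> bool" where
  "nq_differentiable_on n q A y \<longleftrightarrow>
     (\<forall>t\<in>A \<inter> nq_S n q. \<exists>d. (y has_real_derivative d) (at t within A))"

definition nq_term :: "nat \<Rightarrow> real \<Rightarrow> (real \<Rightarrow> real) \<Rightarrow> real \<Rightarrow> nat \<Rightarrow> real" where
  "nq_term n q u x k =
     q ^ nq_bracket n k * x ^ (n ^ k) * (q ^ (n ^ k) * x ^ (n ^ k * (n - 1)) - 1)
       * u (q ^ nq_bracket n k * x ^ (n ^ k))"

definition nq_integral0 :: "nat \<Rightarrow> real \<Rightarrow> (real \<Rightarrow> real) \<Rightarrow> real \<Rightarrow> real" where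
  "nq_integral0 n q u x = - (\<Sum>k. nq_term n q u x k)"

definition nq_integral :: "nat \<Rightarrow> real \<Rightarrow> real \<Rightarrow> real \<Rightarrow> (real \<Rightarrow> real) \<Rightarrow> real" where
  "nq_integral n q a b u = nq_integral0 n q u b - nq_integral0 n q u a"

definition nq_integrable :: "nat \<Rightarrow> real \<Rightarrow> real \<Rightarrow> real \<Rightarrow> (real \<Rightarrow> real) \<Rightarrow> bool" where
  "nq_integrable n q a b u \<longleftrightarrow> summable (nq_term n q u a) \<and> summable (nq_term n q u b)"

text \<open>Functions \<open>A \<rightarrow> \<real>\<close> are represented extensionally (\<open>undefined\<close> outside \<open>A\<close>), so that two
  functions are equal iff they agree on \<open>A\<close>.\<close>

definition nq_E :: "nat \<Rightarrow> real \<Rightarrow> real set \<Rightarrow> (real \<Rightarrow> real) set" where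
  "nq_E n q A = {y \<in> extensional A.
     continuous_on A y \<and> bounded (y ` A) \<and> nq_differentiable_on n q A y \<and>
     continuous_on A (nq_deriv n q A y) \<and> bounded (nq_deriv n q A y ` A)}"

definition nq_admissible ::
    "nat \<Rightarrow> real \<Rightarrow> real \<Rightarrow> real \<Rightarrow> real \<Rightarrow> real \<Rightarrow> (real \<Rightarrow> real) set" where
  "nq_admissible n q a b \<alpha> \<beta> = {y \<in> nq_E n q (nq_set n q a b). y a = \<alpha> \<and> y b = \<beta>}"

definition C1_plane :: "(real \<times> real \<Rightarrow> real) \<Rightarrow> bool" where
  "C1_plane h \<longleftrightarrow>
     (\<exists>h' :: real \<times> real \<Rightarrow> (real \<times> real) \<Rightarrow>\<^sub>L real.
        (\<forall>p. (h has_derivative blinfun_apply (h' p)) (at p)) \<and> continuous_on UNIV h')"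

definition partial2 :: "(real \<Rightarrow> real \<Rightarrow> real \<Rightarrow> real) \<Rightarrow> real \<Rightarrow> real \<Rightarrow> real \<Rightarrow> real" where
  "partial2 F t u v = deriv (\<lambda>w. F t w v) u"

definition partial3 :: "(real \<Rightarrow> real \<Rightarrow> real \<Rightarrow> real) \<Rightarrow> real \<Rightarrow> real \<Rightarrow> real \<Rightarrow> real" where
  "partial3 F t u v = deriv (\<lambda>w. F t u w) v"

definition nq_standing ::
    "nat \<Rightarrow> real \<Rightarrow> real set \<Rightarrow> (real \<Rightarrow> real) set \<Rightarrow> (real \<Rightarrow> real \<Rightarrow> real \<Rightarrow> real) \<Rightarrow> bool" where
  "nq_standing n q A Y F \<longleftrightarrow>
     (\<forall>t\<in>A. C1_plane (\<lambda>(u, v). F t u v)) \<and>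
     (\<forall>y\<in>Y. \<forall>H\<in>{F, partial2 F, partial3 F}.
        continuous_on A (\<lambda>t. H t (y t) (nq_deriv n q A y t)) \<and>
        bounded ((\<lambda>t. H t (y t) (nq_deriv n q A y t)) ` A))"

definition nq_integrand ::
    "nat \<Rightarrow> real \<Rightarrow> real set \<Rightarrow> (real \<Rightarrow> real \<Rightarrow> real \<Rightarrow> real) \<Rightarrow> (real \<Rightarrow> real) \<Rightarrow> real \<Rightarrow> real" where
  "nq_integrand n q A F y t = F t (y (q * t ^ n)) (nq_deriv n q A y t)"

definition nq_functional ::
    "nat \<Rightarrow> real \<Rightarrow> real \<Rightarrow> real \<Rightarrow> (real \<Rightarrow> real \<Rightarrow> real \<Rightarrow> real) \<Rightarrow> (real \<Rightarrow> real) \<Rightarrow> real" where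
  "nq_functional n q a b F y = nq_integral n q a b (nq_integrand n q (nq_set n q a b) F y)"

definition transform :: "real set \<Rightarrow> (real \<Rightarrow> real \<Rightarrow> real) \<Rightarrow> (real \<Rightarrow> real) \<Rightarrow> real \<Rightarrow> real" where
  "transform A z y = (\<lambda>t\<in>A. z t (y t))"

end

theory Submission imports Defs begin

text \<open>The two functionals differ by a constant along corresponding functions, so they order their
  admissible functions in the same way. The reason is a fundamental theorem of calculus for the
  power integral.

  On the open interval \<open>I\<close> the map \<open>t \<mapsto> q * t ^ n\<close> is a contraction towards \<open>0\<close>, the
  orbit of \<open>x\<close> being \<open>q ^ [k] * x ^ n ^ k\<close>. The weight in the \<open>k\<close>-th term of the power integral
  is the difference of two consecutive orbit points, which is exactly the denominator of the power
  difference quotient. Hence the integral of \<open>D g\<close> from \<open>0\<close> to \<open>x\<close> telescopes to \<open>g x - g 0\<close>, the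
  limit \<open>g 0\<close> being reached because differentiability at the fixed point \<open>0\<close> makes \<open>g\<close>
  continuous there (lemma \<open>nq_term_deriv_sums\<close>).

  For \<open>g t = G t (ybar t)\<close> the integral from \<open>a\<close> to \<open>b\<close> is thus \<open>G b (ybar b) - G a (ybar a)\<close>. It
  depends on \<open>ybar\<close> only through its endpoint values, which the boundary conditions prescribe.\<close>

section \<open>The contraction and its orbits\<close>

lemma power_less_reciprocal_iff:
  fixes q r :: real
  assumes "0 < q" and "2 \<le> n" and "0 \<le> r"
  shows "r < q powr (1 / (1 - real n)) \<longleftrightarrow> q * r ^ (n - 1) < 1"
    and "r = q powr (1 / (1 - real n)) \<longleftrightarrow> q * r ^ (n - 1) = 1"
proof -
  define c where "c = q powr (1 / (1 - real n))"
  have "c ^ (n - 1) = q powr (1 / (1 - real n) * real (n - 1))"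
    using assms by (simp add: c_def powr_powr flip: powr_realpow)
  also have "1 / (1 - real n) * real (n - 1) = -1"
    using assms by (simp add: of_nat_diff field_simps)
  finally have c: "c ^ (n - 1) = 1 / q"
    using assms by (simp add: powr_minus_divide)
  have "c > 0" using assms by (simp add: c_def)
  have "r < c \<longleftrightarrow> r ^ (n - 1) < c ^ (n - 1)"
    using assms \<open>c > 0\<close> power_less_imp_less_base[of r "n - 1" c] power_strict_mono[of r c "n - 1"]
    by auto
  then show "r < q powr (1 / (1 - real n)) \<longleftrightarrow> q * r ^ (n - 1) < 1"
    using assms unfolding c by (simp add: c_def field_simps)
  have "r = c \<longleftrightarrow> r ^ (n - 1) = c ^ (n - 1)"
    using assms \<open>c > 0\<close> by (simp add: power_eq_iff_eq_base)
  then show "r = q powr (1 / (1 - real n)) \<longleftrightarrow> q * r ^ (n - 1) = 1"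
    using assms unfolding c by (simp add: c_def field_simps)
qed

text \<open>The factor \<open>q * \<bar>t\<bar> ^ (n - 1)\<close> by which the map \<open>t \<mapsto> q * t ^ n\<close> scales \<open>\<bar>t\<bar>\<close> decides
  membership both in \<open>I\<close> and in \<open>S - {0}\<close>. This puts the cases \<open>n = 1\<close> and \<open>n \<ge> 3\<close>
  on the same footing: \<open>\<theta>\<close> is the point where the factor is \<open>1\<close>, and there is none if
  \<open>n = 1\<close>.\<close>

lemma mem_nq_I_iff:
  assumes "0 < q" and "q < 1" and "1 \<le> n"
  shows "t \<in> nq_I n q \<longleftrightarrow> q * \<bar>t\<bar> ^ (n - 1) < 1"
proof (cases "n = 1")
  case True
  then show ?thesis using assms by (simp add: nq_I_def nq_theta_def)
next
  case False
  then have "t \<in> nq_I n q \<longleftrightarrow> \<bar>t\<bar> < q powr (1 / (1 - real n))"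
    by (auto simp: nq_I_def nq_theta_def)
  then show ?thesis
    using power_less_reciprocal_iff(1)[of q n "\<bar>t\<bar>"] assms False by simp
qed

lemma mem_nq_S_iff:
  assumes "0 < q" and "q < 1" and "1 \<le> n"
  shows "t \<in> nq_S n q \<longleftrightarrow> t = 0 \<or> q * \<bar>t\<bar> ^ (n - 1) = 1"
proof (cases "n = 1")
  case True
  then show ?thesis using assms by (simp add: nq_S_def nq_theta_def)
next
  case False
  moreover have "0 < q powr (1 / (1 - real n))" using assms by simp
  ultimately have "t \<in> nq_S n q \<longleftrightarrow> t = 0 \<or> \<bar>t\<bar> = q powr (1 / (1 - real n))"
    by (auto simp: nq_S_def nq_theta_def)
  then show ?thesis
    using power_less_reciprocal_iff(2)[of q n "\<bar>t\<bar>"] assms False by simp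
qed

lemma nq_bracket_Suc: "nq_bracket n (Suc k) = Suc (n * nq_bracket n k)"
  unfolding nq_bracket_def by (subst sum.lessThan_Suc_shift) (simp add: sum_distrib_left)

lemma nq_orbit_Suc: "nq_orbit n q x (Suc k) = q * nq_orbit n q x k ^ n"
  by (simp add: nq_orbit_def nq_bracket_Suc power_mult_distrib mult.commute flip: power_mult)

lemma nq_orbit_0: "nq_orbit n q x 0 = x"
  by (simp add: nq_orbit_def nq_bracket_def)

text \<open>Since \<open>\<bar>t\<bar>\<close> never grows along an orbit in \<open>I\<close>, the factor of its starting point bounds the
  factor at every later point, and the decay is at least geometric.\<close>

lemma abs_nq_orbit_le:
  assumes "0 < q" and "q < 1" and "1 \<le> n" and "x \<in> nq_I n q"
  shows "\<bar>nq_orbit n q x k\<bar> \<le> \<bar>x\<bar> * (q * \<bar>x\<bar> ^ (n - 1)) ^ k"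
proof (induction k)
  case 0
  show ?case by (simp add: nq_orbit_0)
next
  case (Suc k)
  define r where "r = q * \<bar>x\<bar> ^ (n - 1)"
  have r: "0 \<le> r" "r \<le> 1"
    using assms mem_nq_I_iff[of q n x] by (auto simp: r_def)
  have le: "\<bar>nq_orbit n q x k\<bar> \<le> \<bar>x\<bar> * r ^ k" using Suc by (simp add: r_def)
  also have "\<dots> \<le> \<bar>x\<bar>"
    using r by (simp add: mult_left_le power_le_one)
  finally have "\<bar>nq_orbit n q x k\<bar> ^ (n - 1) \<le> \<bar>x\<bar> ^ (n - 1)"
    by (simp add: power_mono)
  then have "q * \<bar>nq_orbit n q x k\<bar> ^ (n - 1) \<le> r"
    using assms by (simp add: r_def)
  then have "q * \<bar>nq_orbit n q x k\<bar> ^ (n - 1) * \<bar>nq_orbit n q x k\<bar> \<le> r * (\<bar>x\<bar> * r ^ k)"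
    using le r by (intro mult_mono) auto
  moreover have "\<bar>nq_orbit n q x (Suc k)\<bar> = q * \<bar>nq_orbit n q x k\<bar> ^ (n - 1) * \<bar>nq_orbit n q x k\<bar>"
    using assms by (cases n) (simp_all add: nq_orbit_Suc abs_mult power_abs mult_ac)
  ultimately show ?case by (simp add: r_def mult_ac)
qed

lemma nq_orbit_tendsto_0:
  assumes "0 < q" and "q < 1" and "1 \<le> n" and "x \<in> nq_I n q"
  shows "nq_orbit n q x \<longlonglongrightarrow> 0"
proof (rule Lim_null_comparison)
  show "\<forall>\<^sub>F k in sequentially. norm (nq_orbit n q x k) \<le> \<bar>x\<bar> * (q * \<bar>x\<bar> ^ (n - 1)) ^ k"
    using abs_nq_orbit_le[OF assms] by simp
  have "(\<lambda>k. (q * \<bar>x\<bar> ^ (n - 1)) ^ k) \<longlonglongrightarrow> 0"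
    using assms mem_nq_I_iff[of q n x] by (intro LIMSEQ_realpow_zero) auto
  then show "(\<lambda>k. \<bar>x\<bar> * (q * \<bar>x\<bar> ^ (n - 1)) ^ k) \<longlonglongrightarrow> 0"
    by (rule tendsto_mult_right_zero)
qed

lemma nq_orbit_mem_nq_S_iff:
  assumes "0 < q" and "q < 1" and "1 \<le> n" and "x \<in> nq_I n q"
  shows "nq_orbit n q x k \<in> nq_S n q \<longleftrightarrow> nq_orbit n q x k = 0"
proof -
  have r: "0 \<le> q * \<bar>x\<bar> ^ (n - 1)" "q * \<bar>x\<bar> ^ (n - 1) < 1"
    using assms mem_nq_I_iff[of q n x] by auto
  have "\<bar>nq_orbit n q x k\<bar> \<le> \<bar>x\<bar> * (q * \<bar>x\<bar> ^ (n - 1)) ^ k"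
    by (rule abs_nq_orbit_le[OF assms])
  also have "\<dots> \<le> \<bar>x\<bar>"
    using r by (simp add: mult_left_le power_le_one)
  finally have "q * \<bar>nq_orbit n q x k\<bar> ^ (n - 1) \<le> q * \<bar>x\<bar> ^ (n - 1)"
    using assms by (simp add: power_mono)
  then have "q * \<bar>nq_orbit n q x k\<bar> ^ (n - 1) \<noteq> 1" using r by linarith
  then show ?thesis using assms by (simp add: mem_nq_S_iff)
qed

section \<open>The fundamental theorem for the power integral\<close>

lemma nq_term_eq:
  assumes "1 \<le> n"
  shows "nq_term n q u x k
    = (nq_orbit n q x (Suc k) - nq_orbit n q x k) * u (nq_orbit n q x k)"
proof -
  have "n ^ k + n ^ k * (n - 1) = n ^ Suc k"
    using assms by (cases n) auto
  then have "x ^ (n ^ Suc k) = x ^ (n ^ k) * x ^ (n ^ k * (n - 1))"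
    by (simp flip: power_add)
  moreover have "q ^ nq_bracket n (Suc k) = q ^ nq_bracket n k * q ^ (n ^ k)"
    by (simp add: nq_bracket_def power_add)
  ultimately have "nq_orbit n q x (Suc k) - nq_orbit n q x k
      = q ^ nq_bracket n k * x ^ (n ^ k) * (q ^ (n ^ k) * x ^ (n ^ k * (n - 1)) - 1)"
    by (simp add: nq_orbit_def algebra_simps)
  then show ?thesis by (simp add: nq_term_def nq_orbit_def)
qed

text \<open>An orbit in \<open>I\<close> meets the exceptional set \<open>S\<close> only at \<open>0\<close>, where it stays, so
  there both the weight and the difference of values of \<open>g\<close> vanish. At every other orbit point the
  weight cancels the denominator of the difference quotient.\<close>

lemma nq_term_deriv_sums:
  assumes "0 < q" and "q < 1" and "1 \<le> n" and "x \<in> nq_I n q"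
    and "range (nq_orbit n q x) \<subseteq> A" and "0 \<in> A"
    and "nq_differentiable_on n q A g"
  shows "nq_term n q (nq_deriv n q A g) x sums (g 0 - g x)"
proof -
  let ?p = "nq_orbit n q x"
  have "nq_term n q (nq_deriv n q A g) x k = g (?p (Suc k)) - g (?p k)" for k
  proof (cases "?p k = 0")
    case True
    then have "?p (Suc k) = 0" using assms by (simp add: nq_orbit_Suc)
    with True show ?thesis using assms by (simp add: nq_term_eq)
  next
    case False
    then have S: "?p k \<notin> nq_S n q" using nq_orbit_mem_nq_S_iff[OF assms(1-4)] by simp
    have "?p (Suc k) \<noteq> ?p k"
    proof
      assume "?p (Suc k) = ?p k"
      then have "q * ?p k ^ (n - 1) * ?p k = ?p k"
        using assms by (cases n) (simp_all add: nq_orbit_Suc mult_ac)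
      then have "q * ?p k ^ (n - 1) = 1" using False by simp
      then have "q * \<bar>?p k\<bar> ^ (n - 1) = 1"
        using assms(1) by (metis abs_mult abs_one abs_of_pos power_abs)
      then show False using S assms mem_nq_S_iff[of q n] by simp
    qed
    then show ?thesis using S assms by (simp add: nq_term_eq nq_deriv_def nq_orbit_Suc)
  qed
  moreover have "(\<lambda>k. g (?p k)) \<longlonglongrightarrow> g 0"
  proof -
    have "0 \<in> A \<inter> nq_S n q" using assms by (simp add: nq_S_def)
    then obtain d where "(g has_real_derivative d) (at 0 within A)"
      using assms(7) unfolding nq_differentiable_on_def by blast
    then have "continuous (at 0 within A) g"
      by (rule DERIV_continuous)
    then show ?thesis
      using nq_orbit_tendsto_0[OF assms(1-4)] assms(5)
      unfolding continuous_within_sequentially by (auto simp: o_def)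
  qed
  then have "(\<lambda>k. g (?p (Suc k)) - g (?p k)) sums (g 0 - g (?p 0))"
    by (rule telescope_sums)
  ultimately show ?thesis unfolding nq_orbit_0 by (subst sums_cong) auto
qed

lemma nq_integral_deriv:
  assumes "0 < q" and "q < 1" and "1 \<le> n" and "a \<in> nq_I n q" and "b \<in> nq_I n q"
    and "nq_differentiable_on n q (nq_set n q a b) g"
  shows "nq_integral n q a b (nq_deriv n q (nq_set n q a b) g) = g b - g a"
proof -
  have "nq_integral0 n q (nq_deriv n q (nq_set n q a b) g) x = g x - g 0" if "x \<in> {a, b}" for x
  proof -
    have "range (nq_orbit n q x) \<subseteq> nq_set n q a b" "0 \<in> nq_set n q a b" "x \<in> nq_I n q"
      using that assms by (auto simp: nq_set_def)
    then have "nq_term n q (nq_deriv n q (nq_set n q a b) g) x sums (g 0 - g x)"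
      using assms by (intro nq_term_deriv_sums) auto
    then show ?thesis by (simp add: nq_integral0_def flip: sums_unique)
  qed
  then show ?thesis by (simp add: nq_integral_def)
qed

lemma nq_integral_diff:
  assumes "nq_integrable n q a b u" and "nq_integrable n q a b v"
  shows "nq_integral n q a b (\<lambda>t. u t - v t) = nq_integral n q a b u - nq_integral n q a b v"
proof -
  have "nq_term n q (\<lambda>t. u t - v t) x = (\<lambda>k. nq_term n q u x k - nq_term n q v x k)" for x
    by (simp add: nq_term_def fun_eq_iff right_diff_distrib)
  then show ?thesis
    using assms by (simp add: nq_integral_def nq_integral0_def nq_integrable_def flip: suminf_diff)
qed

lemma nq_integral_cong:
  assumes "\<And>t. t \<in> nq_set n q a b \<Longrightarrow> u t = v t"
  shows "nq_integral n q a b u = nq_integral n q a b v"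
proof -
  have "nq_term n q u x = nq_term n q v x" if "x \<in> {a, b}" for x
    using that assms by (auto simp: nq_term_def nq_set_def nq_orbit_def fun_eq_iff)
  then show ?thesis by (simp add: nq_integral_def nq_integral0_def)
qed

section \<open>Transfer of extrema\<close>

text \<open>Being extremal only compares values, hence it survives a bijective change of variable that shifts
  the objective by a constant.\<close>

lemma is_arg_min_bij_betw_shift:
  fixes F H :: "'a \<Rightarrow> real"
  assumes "bij_betw T X Y" and "\<And>x. x \<in> X \<Longrightarrow> F (T x) = H x + c"
    and "is_arg_min H (\<lambda>x. x \<in> X) x0"
  shows "is_arg_min F (\<lambda>y. y \<in> Y) (T x0)"
  using assms by (fastforce simp: is_arg_min_def bij_betw_def)

lemma is_arg_max_bij_betw_shift:
  fixes F H :: "'a \<Rightarrow> real"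
  assumes "bij_betw T X Y" and "\<And>x. x \<in> X \<Longrightarrow> F (T x) = H x + c"
    and "is_arg_max H (\<lambda>x. x \<in> X) x0"
  shows "is_arg_max F (\<lambda>y. y \<in> Y) (T x0)"
  using assms by (fastforce simp: is_arg_max_def bij_betw_def)

theorem lemma31:
  fixes q a b \<alpha> \<beta> :: real and n :: nat
    and f fbar :: "real \<Rightarrow> real \<Rightarrow> real \<Rightarrow> real"
    and z zbar G :: "real \<Rightarrow> real \<Rightarrow> real"
    and ybar_star :: "real \<Rightarrow> real"
  defines "A \<equiv> nq_set n q a b"
    and "Y \<equiv> nq_admissible n q a b \<alpha> \<beta>"
    and "Ybar \<equiv> nq_admissible n q a b (zbar a \<alpha>) (zbar b \<beta>)"
  assumes "0 < q" and "q < 1" and "odd n"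
    and "a \<in> nq_I n q" and "b \<in> nq_I n q" and "a < b"
    and "nq_standing n q A Y f"
    and "nq_standing n q A Ybar fbar"
    and "\<And>y. y \<in> Y \<Longrightarrow> nq_integrable n q a b (nq_integrand n q A f y)"
    and "\<And>ybar. ybar \<in> Ybar \<Longrightarrow> nq_integrable n q a b (nq_integrand n q A fbar ybar)"
    and "\<And>t u. t \<in> A \<Longrightarrow> zbar t (z t u) = u"
    and "\<And>t u. t \<in> A \<Longrightarrow> z t (zbar t u) = u"
    and "bij_betw (transform A z) Ybar Y"
    and "bij_betw (transform A zbar) Y Ybar"
    and "\<And>y ybar. \<lbrakk>y \<in> Y; ybar \<in> Ybar; y = transform A z ybar\<rbrakk> \<Longrightarrow>
           nq_differentiable_on n q A (\<lambda>t. G t (ybar t)) \<and>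
           (\<forall>t\<in>A. nq_integrand n q A f y t - nq_integrand n q A fbar ybar t
                  = nq_deriv n q A (\<lambda>t. G t (ybar t)) t)"
  shows "(is_arg_min (nq_functional n q a b fbar) (\<lambda>y. y \<in> Ybar) ybar_star \<longrightarrow>
            is_arg_min (nq_functional n q a b f) (\<lambda>y. y \<in> Y) (transform A z ybar_star)) \<and>
         (is_arg_max (nq_functional n q a b fbar) (\<lambda>y. y \<in> Ybar) ybar_star \<longrightarrow>
            is_arg_max (nq_functional n q a b f) (\<lambda>y. y \<in> Y) (transform A z ybar_star))"
proof -
  define c where "c = G b (zbar b \<beta>) - G a (zbar a \<alpha>)"
  have shift: "nq_functional n q a b f (transform A z y) = nq_functional n q a b fbar y + c"
    if y: "y \<in> Ybar" for y
  proof -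
    let ?x = "transform A z y" and ?g = "\<lambda>t. G t (y t)"
    have x: "?x \<in> Y" using assms(16) y by (auto simp: bij_betw_def)
    note G = assms(18)[OF x y refl]
    have "nq_functional n q a b f ?x - nq_functional n q a b fbar y
        = nq_integral n q a b (\<lambda>t. nq_integrand n q A f ?x t - nq_integrand n q A fbar y t)"
      using assms(12)[OF x] assms(13)[OF y]
      by (simp add: nq_functional_def A_def nq_integral_diff)
    also have "\<dots> = nq_integral n q a b (nq_deriv n q A ?g)"
      using G by (intro nq_integral_cong) (simp add: A_def)
    also have "\<dots> = ?g b - ?g a"
      using G assms(4-8) unfolding A_def by (intro nq_integral_deriv) (auto simp: odd_pos Suc_leI)
    also have "\<dots> = c"
      using y by (simp add: Ybar_def nq_admissible_def c_def)
    finally show ?thesis by simp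
  qed
  note bij = assms(16)
  show ?thesis
    using is_arg_min_bij_betw_shift[where F = "nq_functional n q a b f"
        and H = "nq_functional n q a b fbar", OF bij shift]
      is_arg_max_bij_betw_shift[where F = "nq_functional n q a b f"
        and H = "nq_functional n q a b fbar", OF bij shift] by blast
qed

end
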